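(* Let $G$ be a disconnected graph with $r \geq 2$ connected components. Then $\mathrm{m}(G\overline{G})= r$.
   Context: All graphs are finite, simple and undirected. The complementary prism $G\overline{G}$ of a graph $G$ is obtained from the disjoint union of $G$ and its complement $\overline{G}$ by adding the edges of the perfect matching joining each vertex $u$ of $G$ to its copy $\overline{u}$ in $\overline{G}$. A path is monophonic if it is an induced (chordless) path. For vertices $u,v$ of a graph $H$, $J_H[u,v]$ is the set of vertices of all monophonic $u,v$-paths in $H$, and for $S\subseteq V(H)$, $J_H[S]=\bigcup_{u,v\in S}J_H[u,v]$. A set $S$ is a monophonic set of $H$ if $J_H[S]=V(H)$; the monophonic number $\mathrm{m}(H)$ is the minimum cardinality of a monophonic set of $H$. *)

theory Defs
  imports "Graph_Theory.Graph_Theory"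
begin

text \<open>
  Finite simple undirected graphs are the locale \<^locale>\<open>pair_graph\<close>: finite, loop-free digraphs
  with a symmetric arc relation, an edge being represented by its two opposite arcs. For such
  graphs the strongly connected components \<^const>\<open>pre_digraph.sccs\<close> are the connected components.
\<close>

definition complement :: "'a pair_pre_digraph \<Rightarrow> 'a pair_pre_digraph" where
  "complement G = \<lparr> pverts = pverts G,
     parcs = {(u, v). u \<in> pverts G \<and> v \<in> pverts G \<and> u \<noteq> v \<and> (u, v) \<notin> parcs G} \<rparr>"

text \<open>\<^term>\<open>Inl u\<close> is the vertex \<open>u\<close> of \<open>G\<close>, and \<^term>\<open>Inr u\<close> its copy in the complement.\<close>

definition complementary_prism :: "'a pair_pre_digraph \<Rightarrow> ('a + 'a) pair_pre_digraph" where
  "complementary_prism G = \<lparr> pverts = pverts G <+> pverts (complement G),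
     parcs = {(Inl u, Inl v) | u v. (u, v) \<in> parcs G}
           \<union> {(Inr u, Inr v) | u v. (u, v) \<in> parcs (complement G)}
           \<union> {(Inl u, Inr u) | u. u \<in> pverts G}
           \<union> {(Inr u, Inl u) | u. u \<in> pverts G} \<rparr>"

text \<open>
  Paths are nonempty lists of distinct vertices; the one-vertex list \<open>[u]\<close> is the path
  from \<open>u\<close> to itself.
\<close>

definition monophonic_path :: "'a pair_pre_digraph \<Rightarrow> 'a \<Rightarrow> 'a list \<Rightarrow> 'a \<Rightarrow> bool" where
  "monophonic_path H u p v \<longleftrightarrow> vpath p (with_proj H) \<and> hd p = u \<and> last p = v \<and>
     (\<forall>i < length p. \<forall>j < length p.
        (p ! i, p ! j) \<in> parcs H \<longrightarrow> j = Suc i \<or> i = Suc j)"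

definition monophonic_interval :: "'a pair_pre_digraph \<Rightarrow> 'a \<Rightarrow> 'a \<Rightarrow> 'a set" where
  "monophonic_interval H u v = \<Union> {set p | p. monophonic_path H u p v}"

definition monophonic_closure :: "'a pair_pre_digraph \<Rightarrow> 'a set \<Rightarrow> 'a set" where
  "monophonic_closure H S = (\<Union>u\<in>S. \<Union>v\<in>S. monophonic_interval H u v)"

definition monophonic_set :: "'a pair_pre_digraph \<Rightarrow> 'a set \<Rightarrow> bool" where
  "monophonic_set H S \<longleftrightarrow> S \<subseteq> pverts H \<and> monophonic_closure H S = pverts H"

definition monophonic_number :: "'a pair_pre_digraph \<Rightarrow> nat" where
  "monophonic_number H = (LEAST k. \<exists>S. monophonic_set H S \<and> card S = k)"

lemma pair_graph_complement:
  assumes "pair_graph G"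
  shows "pair_graph (complement G)"
proof -
  interpret pair_graph G by fact
  have "parcs (complement G) \<subseteq> pverts G \<times> pverts G"
    by (auto simp: complement_def)
  then have "finite (parcs (complement G))"
    by (rule finite_subset) simp
  then show ?thesis
    by unfold_locales
      (auto simp: complement_def symmetric_def intro!: symI dest: arcs_symmetric)
qed

lemma pair_graph_complementary_prism:
  assumes "pair_graph G"
  shows "pair_graph (complementary_prism G)"
proof -
  interpret pair_graph G by fact
  interpret C: pair_graph "complement G" by (rule pair_graph_complement) fact
  have verts_C: "pverts (complement G) = pverts G"
    by (simp add: complement_def)
  have fin: "finite (pverts (complementary_prism G))"
    by (simp add: complementary_prism_def verts_C)
  have wf: "parcs (complementary_prism G)
      \<subseteq> pverts (complementary_prism G) \<times> pverts (complementary_prism G)"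
    using C.wellformed' wellformed' by (fastforce simp: complementary_prism_def verts_C)
  have "finite (parcs (complementary_prism G))"
    using wf by (rule finite_subset) (simp add: fin)
  moreover have "sym (parcs (complementary_prism G))"
    by (rule symI) (auto simp: complementary_prism_def dest: arcs_symmetric C.arcs_symmetric)
  moreover have "fst e \<noteq> snd e" if "e \<in> parcs (complementary_prism G)" for e
    using that no_loops' C.no_loops' by (fastforce simp: complementary_prism_def)
  ultimately show ?thesis
    using fin wf by unfold_locales (auto simp: symmetric_def)
qed

lemma monophonic_set_pverts:
  assumes "pair_graph H"
  shows "monophonic_set H (pverts H)"
proof -
  interpret pair_graph H by fact
  have "x \<in> monophonic_interval H x x" if "x \<in> pverts H" for x
    using that by (auto simp: monophonic_interval_def monophonic_path_def vpath_def vwalk_def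
        dest: no_loops'
        intro!: exI[of _ "{x}"] exI[of _ "[x]"])
  moreover have "monophonic_interval H u v \<subseteq> pverts H" for u v
    by (auto simp: monophonic_interval_def monophonic_path_def vpath_def vwalk_def)
  ultimately show ?thesis
    by (fastforce simp: monophonic_set_def monophonic_closure_def)
qed

end

theory Submission
  imports Defs
begin

text \<open>
  Let \<open>C\<close> be a component of \<open>G\<close>, and write \<open>C'\<close> for its copy in the complement. An induced path
  that starts and ends outside \<open>C \<union> C'\<close> and visits \<open>C\<close> enters \<open>C \<union> C'\<close> from the copy of a vertex
  outside \<open>C\<close>, and leaves \<open>C\<close> through a vertex of \<open>C'\<close>; these two vertices are adjacent but not
  consecutive. So a monophonic set meets every \<open>C \<union> C'\<close>. Conversely, one vertex of \<open>G\<close> from each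
  component suffices: for \<open>v\<close> in the component represented by \<open>c\<close>, and \<open>d\<close> representing another
  one, the path running from \<open>d\<close> through the copies of \<open>d\<close> and \<open>v\<close> to \<open>v\<close>, and then along an
  induced path of \<open>G\<close> to \<open>c\<close>, is induced.
\<close>

section \<open>Induced paths as lists\<close>

text \<open>Recursive form of an induced path, so that explicit paths can be checked by
  simplification. Only arcs from earlier to later entries are constrained; for symmetric
  \<open>E\<close> this is enough.\<close>

fun chordless :: "('a \<times> 'a) set \<Rightarrow> 'a list \<Rightarrow> bool" where
  "chordless E [] \<longleftrightarrow> True"
| "chordless E (x # xs) \<longleftrightarrow> chordless E xs \<and> x \<notin> set xs \<and> (xs \<noteq> [] \<longrightarrow> (x, hd xs) \<in> E)
     \<and> (\<forall>y \<in> set (tl xs). (x, y) \<notin> E)"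

lemma chordless_distinct: "chordless E p \<Longrightarrow> distinct p"
  by (induction p) auto

lemma chordless_vwalk_arcs: "chordless E p \<Longrightarrow> set (vwalk_arcs p) \<subseteq> E"
  by (induction p rule: vwalk_arcs.induct) auto

lemma chordless_nth_arc:
  assumes "chordless E p" "i < j" "j < length p" "(p ! i, p ! j) \<in> E"
  shows "j = Suc i"
  using assms
proof (induction p arbitrary: i j)
  case Nil
  then show ?case by simp
next
  case (Cons x xs)
  obtain k where j: "j = Suc k"
    using Cons.prems(2) by (cases j) auto
  show ?case
  proof (cases i)
    case 0
    \<comment> \<open>The entries that \<open>tl xs\<close> omits are \<open>x\<close> and its
      successor, so an arc from \<open>x\<close> to any later entry would be a chord.\<close>
    have "k = 0"
    proof (rule ccontr)
      assume "k \<noteq> 0"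
      then have "xs ! k \<in> set (tl xs)"
        using Cons.prems(3) j by (cases xs; cases k) auto
      then show False
        using Cons.prems 0 j by auto
    qed
    then show ?thesis
      using 0 j by simp
  next
    case (Suc l)
    then show ?thesis
      using Cons.IH[of l k] Cons.prems j by auto
  qed
qed

lemma chordless_imp_monophonic_path:
  assumes "pair_graph H" "chordless (parcs H) p" "set p \<subseteq> pverts H" "p \<noteq> []"
  shows "monophonic_path H (hd p) p (last p)"
proof -
  interpret pair_graph H by fact
  have "j = Suc i \<or> i = Suc j"
    if "i < length p" "j < length p" "(p ! i, p ! j) \<in> parcs H" for i j
  proof (cases i j rule: linorder_cases)
    case less
    then show ?thesis
      using chordless_nth_arc[OF assms(2)] that by blast
  next
    case equal
    then show ?thesis
      using that no_loops' by blast
  next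
    case greater
    then show ?thesis
      using chordless_nth_arc[OF assms(2)] that arcs_symmetric by blast
  qed
  then show ?thesis
    using assms by (simp add: monophonic_path_def vpath_def vwalk_def chordless_distinct
        chordless_vwalk_arcs)
qed

text \<open>Shortcutting: keep only the part of \<open>p\<close> from the last entry that equals
  \<open>w\<close> or is an out-neighbour of \<open>w\<close>, and start from \<open>w\<close>
  there. By this choice \<open>w\<close> has no chord to what follows.\<close>

lemma chordless_prepend:
  assumes "chordless E p" "w \<in> set p \<or> (\<exists>y \<in> set p. (w, y) \<in> E)"
  shows "\<exists>q. chordless E q \<and> q \<noteq> [] \<and> hd q = w \<and> last q = last p \<and> set q \<subseteq> insert w (set p)"
  using assms
proof (induction p)
  case Nil
  then show ?case by simp
next
  case (Cons x xs)
  show ?case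
  proof (cases "w \<in> set xs \<or> (\<exists>y \<in> set xs. (w, y) \<in> E)")
    case True
    then have "xs \<noteq> []" by auto
    then show ?thesis
      using Cons.IH[OF _ True] Cons.prems(1) by auto
  next
    case False
    show ?thesis
    proof (cases "w = x")
      case True
      then show ?thesis
        using Cons.prems(1) by (intro exI[of _ "x # xs"]) auto
    next
      case neq: False
      then show ?thesis
        using Cons.prems False by (intro exI[of _ "w # x # xs"]) auto
    qed
  qed
qed

text \<open>A walk is built backwards from \<open>c\<close>, shortcutting at each new vertex. The
  last conjunct later confines the path to the component of \<open>c\<close>.\<close>

lemma (in wf_digraph) reachable_imp_chordless:
  assumes "v \<rightarrow>\<^sup>* c"
  shows "\<exists>q. chordless (arcs_ends G) q \<and> q \<noteq> [] \<and> hd q = v \<and> last q = c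
    \<and> (\<forall>y \<in> set q. y \<rightarrow>\<^sup>* c)"
  using assms
proof (induction rule: converse_reachable_induct)
  case base
  then show ?case by (intro exI[of _ "[c]"]) auto
next
  case (step x y)
  then obtain p where p: "chordless (arcs_ends G) p" "p \<noteq> []" "hd p = y" "last p = c"
    "\<forall>z \<in> set p. z \<rightarrow>\<^sup>* c"
    by blast
  then have "\<exists>z \<in> set p. x \<rightarrow> z"
    using step.hyps(1) hd_in_set by blast
  then obtain q where "chordless (arcs_ends G) q" "q \<noteq> []" "hd q = x" "last q = last p"
    "set q \<subseteq> insert x (set p)"
    using chordless_prepend[OF p(1)] by blast
  moreover have "x \<rightarrow>\<^sup>* c"
    using step.hyps by (rule adj_reachable_trans)
  ultimately show ?case
    using p by (intro exI[of _ q]) auto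
qed

section \<open>Adjacency in the complementary prism\<close>

lemma pverts_complementary_prism:
  "pverts (complementary_prism G) = pverts G <+> pverts G"
  by (simp add: complementary_prism_def complement_def)

lemma parcs_complementary_prism [simp]:
  "(Inl u, Inl v) \<in> parcs (complementary_prism G) \<longleftrightarrow> (u, v) \<in> parcs G"
  "(Inr u, Inr v) \<in> parcs (complementary_prism G) \<longleftrightarrow>
     u \<in> pverts G \<and> v \<in> pverts G \<and> u \<noteq> v \<and> (u, v) \<notin> parcs G"
  "(Inl u, Inr v) \<in> parcs (complementary_prism G) \<longleftrightarrow> u = v \<and> u \<in> pverts G"
  "(Inr u, Inl v) \<in> parcs (complementary_prism G) \<longleftrightarrow> u = v \<and> u \<in> pverts G"
  by (auto simp: complementary_prism_def complement_def)

lemma chordless_map_Inl: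
  "chordless (parcs (complementary_prism G)) (map Inl q) \<longleftrightarrow> chordless (parcs G) q"
  by (induction q) (auto simp: hd_map map_tl[symmetric])

section \<open>Lower bound: every component is met\<close>

lemma ex_switch_nat:
  fixes i j :: nat
  assumes "P i" "\<not> P j" "i \<le> j"
  shows "\<exists>k\<ge>i. k < j \<and> P k \<and> \<not> P (Suc k)"
  using assms(3,2)
proof (induction rule: dec_induct)
  case base
  then show ?case using assms(1) by simp
next
  case (step n)
  then show ?case by (cases "P n") (auto intro: less_SucI)
qed

lemma vwalk_nth_arc:
  assumes "vwalk p G" "Suc i < length p"
  shows "(p ! i, p ! Suc i) \<in> arcs_ends G"
proof -
  have "(p ! i, p ! Suc i) \<in> set (vwalk_arcs p)"
    using assms(2)
  proof (induction p arbitrary: i rule: vwalk_arcs.induct)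
    case (3 x y xs)
    then show ?case by (cases i) auto
  qed auto
  then show ?thesis
    using assms(1) by (auto simp: vwalk_def)
qed

lemma monophonic_path_avoids_closed_set:
  assumes "pair_graph G" and mono: "monophonic_path (complementary_prism G) s p t"
    and closed: "\<And>u v. (u, v) \<in> parcs G \<Longrightarrow> u \<in> C \<longleftrightarrow> v \<in> C"
    and s: "s \<notin> C <+> C" and t: "t \<notin> C <+> C" and u: "u \<in> C"
  shows "Inl u \<notin> set p"
proof
  let ?P = "complementary_prism G"
  assume "Inl u \<in> set p"
  then obtain j where j: "j < length p" "p ! j = Inl u"
    by (auto simp: in_set_conv_nth)
  have p: "vwalk p (with_proj ?P)" "hd p = s" "last p = t" "p \<noteq> []"
    and chord: "\<And>i j. i < length p \<Longrightarrow> j < length p \<Longrightarrow> (p ! i, p ! j) \<in> parcs ?P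
      \<Longrightarrow> j = Suc i \<or> i = Suc j"
    using mono j by (auto simp: monophonic_path_def vpath_def)
  have arc: "(p ! i, p ! Suc i) \<in> parcs ?P" if "Suc i < length p" for i
    using vwalk_nth_arc[OF p(1) that] by simp
  have "p ! 0 \<notin> C <+> C"
    using p s by (simp add: hd_conv_nth)
  moreover have "p ! j \<in> C <+> C"
    using j u by (simp add: InlI)
  ultimately obtain k where k: "k < j" "p ! k \<notin> C <+> C" "p ! Suc k \<in> C <+> C"
    using ex_switch_nat[of "\<lambda>i. p ! i \<notin> C <+> C" 0 j] by (metis le0)
  \<comment> \<open>Arcs of \<open>G\<close> respect \<open>C\<close> and matching edges keep the
    underlying vertex, so only an arc of the complement can enter \<open>C <+> C\<close>.\<close>
  then obtain x where x: "p ! k = Inr x" "x \<notin> C"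
    using arc[of k] j(1) closed
    by (cases "p ! k"; cases "p ! Suc k") auto
  have "p ! (length p - 1) \<notin> Inl ` C"
    using p t by (auto simp: last_conv_nth)
  moreover have "p ! j \<in> Inl ` C" "j \<le> length p - 1"
    using j u by auto
  ultimately obtain m where m: "j \<le> m" "m < length p - 1" "p ! m \<in> Inl ` C" "p ! Suc m \<notin> Inl ` C"
    using ex_switch_nat[of "\<lambda>i. p ! i \<in> Inl ` C" j "length p - 1"] by blast
  from m(2) have Suc_m: "Suc m < length p"
    by simp
  obtain b where b: "p ! Suc m = Inr b" "b \<in> C"
    using arc[OF Suc_m] m(3,4) closed by (cases "p ! Suc m") auto
  have "Inr x \<in> set p" "Inr b \<in> set p"
    using nth_mem[of k p] nth_mem[OF Suc_m] x(1) b(1) k(1) j(1) by auto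
  then have "x \<in> pverts G" "b \<in> pverts G"
    using p(1) by (auto simp: vwalk_def pverts_complementary_prism)
  \<comment> \<open>\<open>C\<close> separates \<open>x\<close> from \<open>b\<close>, so they are
    distinct and nonadjacent in \<open>G\<close>. Since \<open>k < j \<le> m\<close>, the positions
    \<open>k\<close> and \<open>Suc m\<close> differ by at least 2, and this arc is a chord.\<close>
  then have "(p ! k, p ! Suc m) \<in> parcs ?P"
    using x b closed by auto
  then show False
    using chord[of k "Suc m"] k(1) m(1) j(1) Suc_m by auto
qed

context pair_graph
begin

lemma sccs_verts_arc_iff:
  assumes "C \<in> sccs_verts" "(u, v) \<in> parcs G"
  shows "u \<in> C \<longleftrightarrow> v \<in> C"
proof -
  have "u \<rightarrow>\<^sup>*\<^bsub>with_proj G\<^esub> v" "v \<rightarrow>\<^sup>*\<^bsub>with_proj G\<^esub> u"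
    using assms(2) arcs_symmetric by auto
  then show ?thesis
    using assms(1) unfolding sccs_verts_def by blast
qed

lemma monophonic_set_meets_component:
  assumes C: "C \<in> sccs_verts" and S: "monophonic_set (complementary_prism G) S"
  shows "S \<inter> (C <+> C) \<noteq> {}"
proof
  assume empty: "S \<inter> (C <+> C) = {}"
  obtain u where u: "u \<in> C" "u \<in> pverts G"
    using C sccs_verts_subsets[OF C] by (force simp: sccs_verts_def)
  then have "Inl u \<in> monophonic_closure (complementary_prism G) S"
    using S by (auto simp: monophonic_set_def pverts_complementary_prism)
  then obtain s t p where "s \<in> S" "t \<in> S" "monophonic_path (complementary_prism G) s p t"
    "Inl u \<in> set p"
    by (auto simp: monophonic_closure_def monophonic_interval_def)
  then show False
    using monophonic_path_avoids_closed_set[OF pair_graph_axioms _ sccs_verts_arc_iff[OF C]]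
      empty u(1) by blast
qed

lemma card_sccs_le_monophonic_set:
  assumes S: "monophonic_set (complementary_prism G) S"
  shows "card sccs_verts \<le> card S"
proof -
  have "\<forall>C \<in> sccs_verts. \<exists>x. x \<in> S \<inter> (C <+> C)"
    using monophonic_set_meets_component[OF _ S] by blast
  then obtain f where f: "\<And>C. C \<in> sccs_verts \<Longrightarrow> f C \<in> S \<inter> (C <+> C)"
    by metis
  have "inj_on f sccs_verts"
  proof (rule inj_onI)
    fix C D assume CD: "C \<in> sccs_verts" "D \<in> sccs_verts" "f C = f D"
    then have "f C \<in> C <+> C" "f C \<in> D <+> D"
      using f by (blast, metis IntD2)
    then have "C \<inter> D \<noteq> {}"
      by auto
    then show "C = D"
      using sccs_verts_disjoint CD by blast
  qed
  \<comment> \<open>Finiteness matters because an infinite set has \<open>card\<close> 0.\<close>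
  moreover have "finite S"
    using S by (auto simp: monophonic_set_def pverts_complementary_prism intro: finite_subset)
  ultimately show ?thesis
    using f by (intro card_inj_on_le) auto
qed

section \<open>Upper bound: one representative per component\<close>

lemma monophonic_set_of_representatives:
  assumes two: "card sccs_verts \<ge> 2" and c: "\<And>C. C \<in> sccs_verts \<Longrightarrow> c C \<in> C"
  shows "monophonic_set (complementary_prism G) (Inl ` c ` sccs_verts)"
proof -
  let ?P = "complementary_prism G" and ?S = "Inl ` c ` sccs_verts :: ('a + 'a) set"
  interpret P: pair_graph ?P
    by (rule pair_graph_complementary_prism) (rule pair_graph_axioms)
  have sub: "?S \<subseteq> pverts ?P"
    using c sccs_verts_subsets by (fastforce simp: pverts_complementary_prism)
  have cover: "{Inl v, Inr v} \<subseteq> monophonic_closure ?P ?S" if v: "v \<in> pverts G" for v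
  proof -
    define C where "C = scc_of v"
    have C: "C \<in> sccs_verts" "v \<in> C"
      using v by (auto simp: C_def intro: scc_of_in_sccs_verts in_scc_of_self)
    have "\<not> sccs_verts \<subseteq> {C}"
      using two card_mono[of "{C}" sccs_verts] by auto
    then obtain D where D: "D \<in> sccs_verts" "D \<noteq> C"
      by blast
    define d where "d = c D"
    have d: "d \<in> D" "d \<in> pverts G" "d \<notin> C"
      using c[OF D(1)] sccs_verts_subsets[OF D(1)] sccs_verts_disjoint[OF D(1) C(1) D(2)]
      by (auto simp: d_def)
    have "v \<rightarrow>\<^sup>*\<^bsub>with_proj G\<^esub> c C"
      using C c[OF C(1)] by (auto simp: sccs_verts_def)
    then obtain q where q: "chordless (parcs G) q" "q \<noteq> []" "hd q = v" "last q = c C"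
      "\<forall>y \<in> set q. y \<rightarrow>\<^sup>*\<^bsub>with_proj G\<^esub> c C"
      using reachable_imp_chordless[of v "c C"] unfolding with_proj_simps by blast
    \<comment> \<open>By symmetry of \<open>G\<close>, reaching \<open>c C\<close> means mutual
      reachability, and \<open>C\<close> is maximal for that.\<close>
    have qC: "set q \<subseteq> C"
    proof
      fix y assume "y \<in> set q"
      then have "y \<rightarrow>\<^sup>*\<^bsub>with_proj G\<^esub> c C" "c C \<rightarrow>\<^sup>*\<^bsub>with_proj G\<^esub> y"
        using q(5) symmetric_reachable' by auto
      then show "y \<in> C"
        using C(1) c[OF C(1)] unfolding sccs_verts_def by blast
    qed
    have no_arc: "(d, y) \<notin> parcs G" if "y \<in> C" for y
      using sccs_verts_arc_iff[OF C(1)] d(3) that by blast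
    obtain q' where q': "q = v # q'"
      using q(2,3) by (cases q) auto
    define p where "p = Inl d # Inr d # Inr v # map Inl q"
    \<comment> \<open>\<open>Inr d\<close> and \<open>Inr v\<close> are adjacent because
      \<open>d\<close> lies outside \<open>C\<close>. Their only neighbours among the
      \<open>Inl\<close> vertices are \<open>Inl d\<close> and \<open>Inl v\<close>, the latter
      being the head of \<open>map Inl q\<close>; and \<open>d\<close> has no neighbour in
      \<open>C\<close>.\<close>
    have "chordless (parcs ?P) p"
      using q(1) qC d v C(2) no_arc chordless_map_Inl[of G q]
      by (auto simp: p_def q')
    moreover have "set p \<subseteq> pverts ?P"
      using qC d v sccs_verts_subsets[OF C(1)] by (auto simp: p_def pverts_complementary_prism)
    moreover have "hd p = Inl (c D)" "last p = Inl (c C)" "p \<noteq> []"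
      using q(2,4) by (auto simp: p_def d_def last_map)
    ultimately have "monophonic_path ?P (Inl (c D)) p (Inl (c C))"
      using chordless_imp_monophonic_path[OF P.pair_graph_axioms] by metis
    then have "set p \<subseteq> monophonic_closure ?P ?S"
      using C(1) D(1) unfolding monophonic_closure_def monophonic_interval_def by blast
    then show ?thesis
      by (simp add: p_def q')
  qed
  have "monophonic_closure ?P ?S \<subseteq> pverts ?P"
    by (auto simp: monophonic_closure_def monophonic_interval_def monophonic_path_def vpath_def
        vwalk_def)
  then show ?thesis
    using sub cover by (auto simp: monophonic_set_def pverts_complementary_prism)
qed

end

theorem theorem4p1:
  fixes G :: "'a pair_pre_digraph" and r :: nat
  assumes "pair_graph G"
    and "\<not> Digraph_Component.connected (with_proj G)"
    and "card (pre_digraph.sccs (with_proj G)) = r"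
    and "r \<ge> 2"
  shows "monophonic_number (complementary_prism G) = r"
proof -
  interpret pair_graph G by fact
  have r: "card sccs_verts = r"
    using assms(3) card_sccs_verts by simp
  \<comment> \<open>Components are nonempty, so representatives can be chosen; disjointness makes
    the choice injective and gives exactly \<open>r\<close> of them.\<close>
  obtain c where c: "\<And>C. C \<in> sccs_verts \<Longrightarrow> c C \<in> C"
    unfolding sccs_verts_def by (metis (mono_tags, lifting) ex_in_conv mem_Collect_eq)
  have "inj_on c sccs_verts"
    using c sccs_verts_disjoint by (metis disjoint_iff inj_onI)
  then have "card (Inl ` c ` sccs_verts :: ('a + 'a) set) = r"
    using r by (simp add: card_image)
  moreover have "monophonic_set (complementary_prism G) (Inl ` c ` sccs_verts)"
    using monophonic_set_of_representatives c r assms(4) by simp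
  ultimately show ?thesis
    unfolding monophonic_number_def
    using card_sccs_le_monophonic_set r by (intro Least_equality) auto
qed

end
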